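(* Consider a connected pipe network with $N$ nodes, $M$ pipes and $N_0$ fixed-energy nodes ($1\le N_0<N$), with incidence matrix $C=\begin{pmatrix}C^{(1)}\\ C^{(2)}\end{pmatrix}$, inverse inertia matrix $D=\mathrm{diag}(1/I_1,\ldots,1/I_M)$ with all $I_m>0$, fixed energies $\bm{h}^{(2)}\in\mathbb{R}^{N_0}$, and external demands $\tilde{\bm{Q}}^{\rm ext}\in\mathbb{R}^{N-N_0}$. Consider the dynamical system for the flow rates $\bm{Q}=(Q_1,\ldots,Q_M)^{\top}$ $$\frac{{\rm d}\bm{Q}}{{\rm d}t}=DC^{\top}\begin{pmatrix}\left(C^{(1)}DC^{(1)\top}\right)^{-1}\left(-C^{(1)}DC^{(2)\top}\bm{h}^{(2)}+C^{(1)}D\,\bm{q}(\bm{Q})\right)\\ \bm{h}^{(2)}\end{pmatrix}-D\,\bm{q}(\bm{Q}),$$ whose dynamics are confined to the affine subspace $\mathcal{H}=\{\bm{Q}\in\mathbb{R}^M: C^{(1)}\bm{Q}=-\tilde{\bm{Q}}^{\rm ext}\}$. Let $\bm{Q}^*=(Q_1^*,\ldots,Q_M^* )^{\top}\in\mathcal{H}$ be a steady state of this system such that $q_m'(Q_m^* )>0$ for every $m\in\{1,\ldots,M\}$. Then $\bm{Q}^*$ is linearly stable under the dynamics constrained to $\mathcal{H}$: the Jacobian matrix $J^{\rm dyn}$ of the right-hand side at $\bm{Q}^*$ maps the tangent space $\ker C^{(1)}$ of $\mathcal{H}$ into itself, and all $M-N+N_0$ eigenvalues (counted with multiplicity) of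 the restriction of $J^{\rm dyn}$ to $\ker C^{(1)}$ are real and negative.
   Context: The network is a connected undirected graph without self-loops, with $N$ nodes (indexed $1,\ldots,N$) and $M$ edges, called pipes (indexed $1,\ldots,M$). The total energies $h_i$ of the last $N_0$ nodes $i=N-N_0+1,\ldots,N$ (reservoirs) are fixed constants, collected in $\bm{h}^{(2)}=(h_{N-N_0+1},\ldots,h_N)^{\top}$. The incidence matrix $C$ is the $N\times M$ matrix such that, if the $m$th pipe joins nodes $i$ and $j$ (with an arbitrarily chosen orientation from $i$ to $j$), then $C_{i,m}=1$, $C_{j,m}=-1$ and all other entries of column $m$ are zero. $C^{(1)}$ is the $(N-N_0)\times M$ block formed by the first $N-N_0$ rows of $C$ (nodes whose energy is not fixed) and $C^{(2)}$ is the $N_0\times M$ block formed by the last $N_0$ rows. $I_m>0$ is the inertia constant of pipe $m$. The matrix $C^{(1)}DC^{(1)\top}$ is invertible. $Q_m$ is the flow rate through pipe $m$ in its chosen orientation, and $\bm{q}(\bm{Q})=(q_1(Q_1),\ldots,q_M(Q_M))^{\top}$ with $q_m(Q_m)=R_mQ_m|Q_m|+u(Q_m)$, where $R_m$ is the pipe coefficient (which may itself depend on $Q_m$ through the friction factor) and $u$ is an input term; $q_m$ is a differentiable real function and $q_m'$ denotes its derivative with respect to $Q_m$. The constraint $C^{(1)}\bm{Q}=-\tilde{\bm{Q}}^{\rm ext}$ is conservation of water mass (Kirchhoff's current law) at the nodes $1,\ldots,N-N_0$, where $\tilde{Q}^{\rm ext}_i$ is the external water demand at node $i$. The Jacobian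 matrix at the steady state is $$J^{\rm dyn}=\left[DC^{(1)\top}\left(C^{(1)}DC^{(1)\top}\right)^{-1}C^{(1)}D-D\right]\mathrm{diag}\left(q_1'(Q_1^* ),\ldots,q_M'(Q_M^* )\right).$$ *)

theory Defs
  imports
    "Jordan_Normal_Form.Char_Poly"
    "HOL-Analysis.Analysis"
begin

hide_const (open) Matrix.mat Matrix.vec Matrix.vec_index Determinant.det
no_notation Matrix.vec_index (infixl \<open>$\<close> 100)

text \<open>
  Nodes form the type \<open>'f + 'r\<close>: the left summand \<open>'f\<close> stands for the nodes \<open>1, \<dots>, N - N\<^sub>0\<close> of
  unknown energy, the right summand \<open>'r\<close> for the last \<open>N\<^sub>0\<close> nodes (reservoirs). Types are nonempty,
  so \<open>1 \<le> N\<^sub>0 < N\<close> is built in. Pipe \<open>m\<close> is oriented from \<open>src m\<close> to \<open>tgt m\<close>; parallel pipes are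
  not excluded.
\<close>

definition no_self_loops :: "('m \<Rightarrow> 'n) \<Rightarrow> ('m \<Rightarrow> 'n) \<Rightarrow> bool" where
  "no_self_loops src tgt \<longleftrightarrow> (\<forall>m. src m \<noteq> tgt m)"

definition adjacent :: "('m \<Rightarrow> 'n) \<Rightarrow> ('m \<Rightarrow> 'n) \<Rightarrow> 'n \<Rightarrow> 'n \<Rightarrow> bool" where
  "adjacent src tgt i j \<longleftrightarrow> (\<exists>m. (src m = i \<and> tgt m = j) \<or> (src m = j \<and> tgt m = i))"

definition connected_graph :: "('m \<Rightarrow> 'n) \<Rightarrow> ('m \<Rightarrow> 'n) \<Rightarrow> bool" where
  "connected_graph src tgt \<longleftrightarrow> (\<forall>i j. (adjacent src tgt)\<^sup>*\<^sup>* i j)"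

definition incidence_matrix :: "('m::finite \<Rightarrow> 'n::finite) \<Rightarrow> ('m \<Rightarrow> 'n) \<Rightarrow> real^'m^'n" where
  "incidence_matrix src tgt = (\<chi> i m. if i = src m then 1 else if i = tgt m then - 1 else 0)"

definition upper_block :: "real^'m::finite^('f::finite + 'r::finite) \<Rightarrow> real^'m^'f" where
  "upper_block C = (\<chi> i. C $ Inl i)"

definition lower_block :: "real^'m::finite^('f::finite + 'r::finite) \<Rightarrow> real^'m^'r" where
  "lower_block C = (\<chi> i. C $ Inr i)"

definition stack :: "real^'f::finite \<Rightarrow> real^'r::finite \<Rightarrow> real^('f + 'r)" where
  "stack x y = (\<chi> i. case i of Inl a \<Rightarrow> x $ a | Inr b \<Rightarrow> y $ b)"

definition diag :: "real^'m::finite \<Rightarrow> real^'m^'m" where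
  "diag v = (\<chi> i j. if i = j then v $ i else 0)"

definition inv_inertia :: "('m::finite \<Rightarrow> real) \<Rightarrow> real^'m^'m" where
  "inv_inertia I = diag (\<chi> m. 1 / I m)"

text \<open>The pipe coefficient \<open>R m\<close> may depend on the flow rate, hence it is a function of it.\<close>

definition pipe_q :: "('m \<Rightarrow> real \<Rightarrow> real) \<Rightarrow> ('m \<Rightarrow> real \<Rightarrow> real) \<Rightarrow> 'm \<Rightarrow> real \<Rightarrow> real" where
  "pipe_q R u m x = R m x * x * \<bar>x\<bar> + u m x"

definition flow_rhs ::
  "real^'m::finite^('f::finite + 'r::finite) \<Rightarrow> real^'m^'m \<Rightarrow> real^'r \<Rightarrow> ('m \<Rightarrow> real \<Rightarrow> real)
    \<Rightarrow> real^'m \<Rightarrow> real^'m" where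
  "flow_rhs C D h2 q Q =
    (let C1 = upper_block C :: real^'m^'f;
         C2 = lower_block C :: real^'m^'r;
         qQ = (\<chi> m. q m (Q $ m))
     in (D ** transpose C) *v
          stack (matrix_inv (C1 ** D ** transpose C1) *v
                   (- ((C1 ** D ** transpose C2) *v h2) + (C1 ** D) *v qQ))
                h2
        - D *v qQ)"

definition J_dyn ::
  "real^'m::finite^'f::finite \<Rightarrow> real^'m^'m \<Rightarrow> ('m \<Rightarrow> real \<Rightarrow> real) \<Rightarrow> real^'m \<Rightarrow> real^'m^'m" where
  "J_dyn C1 D q Q =
    (D ** transpose C1 ** matrix_inv (C1 ** D ** transpose C1) ** C1 ** D - D)
      ** diag (\<chi> m. deriv (q m) (Q $ m))"

definition flow_space :: "real^'m::finite^'f::finite \<Rightarrow> real^'f \<Rightarrow> (real^'m) set" where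
  "flow_space C1 Qext = {Q. C1 *v Q = - Qext}"

definition matrix_ker :: "real^'m::finite^'f::finite \<Rightarrow> (real^'m) set" where
  "matrix_ker A = {v. A *v v = 0}"

definition solves_on :: "(real^'m::finite \<Rightarrow> real^'m) \<Rightarrow> (real \<Rightarrow> real^'m) \<Rightarrow> real set \<Rightarrow> bool" where
  "solves_on F Q S \<longleftrightarrow> (\<forall>t\<in>S. (Q has_vector_derivative F (Q t)) (at t within S))"

definition basis_list_of :: "(real^'m::finite) set \<Rightarrow> (real^'m) list \<Rightarrow> bool" where
  "basis_list_of V bs \<longleftrightarrow> distinct bs \<and> independent (set bs) \<and> span (set bs) = V"

text \<open>
  For \<open>bs\<close> a basis of an \<open>f\<close>-invariant subspace, the matrix of the restriction of \<open>f\<close> in that basis: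
  column \<open>j\<close> contains the coordinates of the image of the \<open>j\<close>-th basis vector. The multiset of
  eigenvalues consists of the complex roots of its characteristic polynomial, with multiplicity.
\<close>

definition restriction_matrix :: "(real^'m::finite \<Rightarrow> real^'m) \<Rightarrow> (real^'m) list \<Rightarrow> real Matrix.mat" where
  "restriction_matrix f bs =
     Matrix.mat (length bs) (length bs) (\<lambda>(i, j). representation (set bs) (f (bs ! j)) (bs ! i))"

definition restriction_eigenvalues ::
  "(real^'m::finite \<Rightarrow> real^'m) \<Rightarrow> (real^'m) list \<Rightarrow> complex multiset" where
  "restriction_eigenvalues f bs =
     proots (char_poly (map_mat complex_of_real (restriction_matrix f bs)))"

end

theory Submission
  imports Defs "HOL-Computational_Algebra.Fundamental_Theorem_Algebra"
begin

text \<open>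
  Let \<open>P w\<close> be the component of \<open>w\<close> along \<open>ker (C1 D)\<close> in the decomposition that is orthogonal for the
  weight \<open>D\<close>, the other component lying in the range of \<open>C1\<^sup>T\<close>. The flow is
  \<open>D P (C2\<^sup>T h2 - q(Q))\<close> and the Jacobian is \<open>- D P E\<close> with \<open>E\<close> the diagonal matrix of the
  derivatives, so \<open>C1\<close> annihilates both. Since \<open>D P\<close> is symmetric and positive semidefinite with
  kernel the range of \<open>C1\<^sup>T\<close>, the Jacobian is self-adjoint for the inner product \<open>u \<bullet> E v\<close> and
  negative definite on \<open>ker C1\<close>. Connectivity to a reservoir makes \<open>C1\<^sup>T\<close> injective, which gives
  the invertibility and the dimension count.
\<close>

no_notation Matrix.scalar_prod (infix \<open>\<bullet>\<close> 70)

section \<open>Transposes, diagonal matrices and dimensions of kernels\<close>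

lemma inner_transpose_mult: "(transpose A *v x) \<bullet> y = x \<bullet> (A *v y)"
  for A :: "real^'m::finite^'n::finite"
  using dot_lmul_matrix[of x A y] by simp

lemma diag_mult_nth [simp]: "(diag d *v v) $ i = d $ i * v $ i"
  by (simp add: diag_def matrix_vector_mult_def if_distrib[of "\<lambda>a. a * _"] cong: if_cong)

lemma inner_diag: "x \<bullet> (diag d *v y) = (diag d *v x) \<bullet> y"
  by (simp add: inner_vec_def mult_ac)

lemma inner_diag_nonneg: "(\<And>i. d $ i \<ge> 0) \<Longrightarrow> x \<bullet> (diag d *v x) \<ge> 0"
  by (auto simp: inner_vec_def mult.left_commute[of "x $ _"] intro!: sum_nonneg)

lemma inner_diag_eq_0:
  assumes "\<And>i. d $ i > 0" and "x \<bullet> (diag d *v x) = 0"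
  shows "x = 0"
proof -
  have "(\<Sum>i\<in>UNIV. d $ i * (x $ i * x $ i)) = 0"
    using assms(2) by (simp add: inner_vec_def mult_ac)
  then have "\<forall>i\<in>UNIV. d $ i * (x $ i * x $ i) = 0"
    using assms(1) by (subst (asm) sum_nonneg_eq_0_iff) (auto simp: less_imp_le)
  then show ?thesis
    using assms(1) by (auto simp: vec_eq_iff) (metis less_irrefl)
qed

lemma matrix_inv_right: "invertible B \<Longrightarrow> B ** matrix_inv B = Finite_Cartesian_Product.mat 1"
  unfolding invertible_def matrix_inv_def by (rule someI2_ex) auto

text \<open>The set-builder form, with the vacuous-looking \<open>y \<in> UNIV\<close>, is the one
  that \<open>dim_subspace_orthogonal_to_vectors\<close> speaks of.\<close>

lemma matrix_ker_orthogonal: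
  "matrix_ker A = {y \<in> UNIV. \<forall>x \<in> range ((*v) (transpose A)). orthogonal x y}"
proof -
  \<comment> \<open>Testing with \<open>x = A *v y\<close> makes the squared norm of
    \<open>A *v y\<close> vanish.\<close>
  have "A *v y = 0" if "\<And>x. (transpose A *v x) \<bullet> y = 0" for y
    using that[of "A *v y"] by (simp only: inner_transpose_mult) simp
  moreover have "(transpose A *v x) \<bullet> y = 0" if "A *v y = 0" for x y
    by (simp only: inner_transpose_mult that) simp
  ultimately show ?thesis
    by (auto simp: matrix_ker_def orthogonal_def simp del: transpose_matrix_vector)
qed

lemma dim_matrix_ker:
  fixes A :: "real^'m::finite^'f::finite"
  assumes "inj ((*v) (transpose A))"
  shows "dim (matrix_ker A) + CARD('f) = CARD('m)"
proof -
  have "dim (range ((*v) (transpose A))) = CARD('f)"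
    using dim_image_eq[OF matrix_vector_mul_linear, of "transpose A" UNIV] assms
    by (simp del: transpose_matrix_vector)
  moreover have "subspace (range ((*v) (transpose A)))"
    by (intro linear_subspace_image matrix_vector_mul_linear) simp
  ultimately show ?thesis
    using dim_subspace_orthogonal_to_vectors[of "range ((*v) (transpose A))" UNIV]
    by (simp add: matrix_ker_orthogonal)
qed

subsection \<open>Weighted projections\<close>

text \<open>The network enters the spectral argument only through these two properties; connectivity
  will supply the second.\<close>

locale weighted_projection =
  fixes A :: "real^'m::finite^'f::finite" and d :: "real^'m"
  assumes weight_pos: "d $ i > 0"
    and transpose_inj: "transpose A *v x = 0 \<Longrightarrow> x = 0"
begin

text \<open>The residual of the weighted least squares fit of \<open>w\<close> by vectors
  \<open>transpose A *v p\<close>; the fitted \<open>p\<close> solves the normal equations.\<close>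

definition residual :: "real^'m \<Rightarrow> real^'m" where
  "residual w = w - transpose A *v
     (matrix_inv (A ** diag d ** transpose A) *v (A *v (diag d *v w)))"

lemma inj_transpose: "inj ((*v) (transpose A))"
  unfolding linear_injective_0[OF matrix_vector_mul_linear] using transpose_inj by blast

text \<open>The quadratic form of this matrix at \<open>x\<close> is the weighted squared norm of
  \<open>transpose A *v x\<close>, so positive weights and injectivity leave no kernel.\<close>

lemma gram_invertible: "invertible (A ** diag d ** transpose A)"
proof -
  have "x = 0" if "(A ** diag d ** transpose A) *v x = 0" for x
  proof -
    have "(transpose A *v x) \<bullet> (diag d *v (transpose A *v x)) = 0"
      using that inner_transpose_mult[of A x "diag d *v (transpose A *v x)"]
      by (simp only: matrix_vector_mul_assoc matrix_mul_assoc) simp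
    then show ?thesis
      using inner_diag_eq_0[OF weight_pos] transpose_inj by blast
  qed
  then show ?thesis
    by (simp add: invertible_left_inverse matrix_left_invertible_ker)
qed

lemma mult_weighted_residual [simp]: "A *v (diag d *v residual w) = 0"
proof -
  let ?G = "A ** diag d ** transpose A"
  have "A *v (diag d *v residual w) = A *v (diag d *v w)
      - ?G *v (matrix_inv ?G *v (A *v (diag d *v w)))"
    by (simp only: residual_def matrix_vector_mult_diff_distrib matrix_vector_mul_assoc
        matrix_mul_assoc)
  also have "?G *v (matrix_inv ?G *v y) = y" for y
    by (simp only: matrix_vector_mul_assoc matrix_inv_right[OF gram_invertible]) simp
  finally show ?thesis by simp
qed

text \<open>The part of \<open>x\<close> removed by \<open>residual\<close> lies in the range of
  \<open>transpose A\<close>, which is orthogonal to every weighted residual. Symmetry and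
  semidefiniteness both follow from this form.\<close>

lemma inner_weighted_residual:
  "x \<bullet> (diag d *v residual y) = residual x \<bullet> (diag d *v residual y)"
proof -
  have "(transpose A *v p) \<bullet> (diag d *v residual y) = 0" for p
    by (simp only: inner_transpose_mult mult_weighted_residual) simp
  then show ?thesis by (simp add: residual_def[of x] inner_diff_left del: transpose_matrix_vector)
qed

lemma inner_weighted_residual_commute:
  "x \<bullet> (diag d *v residual y) = y \<bullet> (diag d *v residual x)"
  by (metis inner_commute inner_diag inner_weighted_residual)

lemma linear_residual: "linear residual"
  unfolding residual_def
  by (intro linearI) (simp_all add: matrix_vector_right_distrib matrix_vector_mult_scaleR
      algebra_simps del: transpose_matrix_vector)

text \<open>The form degenerates only on the range of \<open>transpose A\<close>, which is
  orthogonal to the kernel of \<open>A\<close>; the witness \<open>x\<close> certifies that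
  \<open>w\<close> lies outside that range.\<close>

lemma inner_weighted_residual_pos:
  assumes "x \<bullet> w \<noteq> 0" and "A *v x = 0"
  shows "w \<bullet> (diag d *v residual w) > 0"
proof (rule ccontr)
  assume "\<not> ?thesis"
  then have "residual w \<bullet> (diag d *v residual w) \<le> 0"
    using inner_weighted_residual[of w w] by linarith
  then have "residual w \<bullet> (diag d *v residual w) = 0"
    using inner_diag_nonneg[of d "residual w"] weight_pos
    by (intro order.antisym) (auto intro: less_imp_le)
  then have "residual w = 0"
    using inner_diag_eq_0 weight_pos by blast
  then obtain p where "w = transpose A *v p"
    by (simp add: residual_def del: transpose_matrix_vector)
  then have "w \<bullet> x = 0"
    using assms(2) by (simp only: inner_transpose_mult) simp
  then show False using assms(1) by (simp add: inner_commute)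
qed

end

subsection \<open>Eigenvalues of restrictions\<close>

text \<open>Here \<open>x\<close> and \<open>y\<close> are the real and imaginary parts of an
  eigenvector for \<open>a + i b\<close>. Working with the pair avoids complexifying the space and
  the form \<open>B\<close>.\<close>

lemma self_adjoint_negative_eigenvalue:
  fixes f :: "'a::real_vector \<Rightarrow> 'a" and B :: "'a \<Rightarrow> 'a \<Rightarrow> real"
  assumes V: "x \<in> V" "y \<in> V" "x \<noteq> 0 \<or> y \<noteq> 0"
    and fx: "f x = a *\<^sub>R x - b *\<^sub>R y" and fy: "f y = b *\<^sub>R x + a *\<^sub>R y"
    and B_linear: "\<And>u. linear (B u)"
    and B_commute: "\<And>u v. B u v = B v u"
    and B_pos: "\<And>u. u \<noteq> 0 \<Longrightarrow> B u u > 0"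
    and adj: "\<And>u v. B u (f v) = B v (f u)"
    and neg: "\<And>u. u \<in> V \<Longrightarrow> u \<noteq> 0 \<Longrightarrow> B u (f u) < 0"
  shows "b = 0 \<and> a < 0"
proof -
  have nonneg: "B u u \<ge> 0" for u
    using B_pos[of u] linear_0[OF B_linear, of u] by (cases "u = 0") auto
  note lin = linear_diff[OF B_linear] linear_add[OF B_linear] linear_scale[OF B_linear]
  \<comment> \<open>The terms with \<open>a\<close> cancel because \<open>B\<close> is
    symmetric.\<close>
  have "b * (B x x + B y y) = B x (f y) - B y (f x)"
    by (simp add: fx fy lin B_commute[of y x] algebra_simps)
  then have "b * (B x x + B y y) = 0"
    using adj by simp
  moreover have "B x x + B y y > 0"
    using V(3) B_pos[of x] B_pos[of y] nonneg[of x] nonneg[of y] by fastforce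
  ultimately have b: "b = 0" by simp
  have "a * B u u < 0" if "u \<in> V" "u \<noteq> 0" "f u = a *\<^sub>R u" for u
    using neg[OF that(1,2)] that(3) by (simp add: lin)
  \<comment> \<open>With \<open>b = 0\<close>, whichever of \<open>x\<close> and \<open>y\<close> is
    nonzero is a real eigenvector for \<open>a\<close>.\<close>
  then have "a < 0"
    using V fx fy b nonneg by (metis (full_types) add_0 diff_zero mult_less_0_iff not_less scale_zero_left)
  with b show ?thesis by simp
qed

text \<open>Invariance of \<open>V\<close> makes the matrix entries genuine coordinates:
  \<open>representation\<close> is zero by default outside the span.\<close>

lemma sum_restriction_matrix_column:
  assumes "basis_list_of V bs" and "f ` V \<subseteq> V" and j: "j < length bs"
  shows "(\<Sum>i<length bs. restriction_matrix f bs $$ (i, j) *\<^sub>R bs ! i) = f (bs ! j)"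
proof -
  have bs: "distinct bs" "independent (set bs)" "span (set bs) = V"
    using assms(1) by (auto simp: basis_list_of_def)
  have "f (bs ! j) \<in> span (set bs)"
    using assms(2) bs(3) span_base[OF nth_mem[OF j]] by auto
  then have "f (bs ! j) = (\<Sum>b\<in>set bs. representation (set bs) (f (bs ! j)) b *\<^sub>R b)"
    using sum_representation_eq[OF bs(2), of _ "set bs"] by simp
  also have "\<dots> = (\<Sum>i<length bs. representation (set bs) (f (bs ! j)) (bs ! i) *\<^sub>R bs ! i)"
    by (rule sum.reindex_bij_betw[symmetric]) (rule bij_betw_nth[OF bs(1) refl refl])
  finally show ?thesis
    using j by (simp add: restriction_matrix_def)
qed

lemma sum_scaleR_nth_eq_0:
  assumes "distinct bs" "independent (set bs)"
    and "(\<Sum>i<length bs. c i *\<^sub>R bs ! i) = 0" and k: "k < length bs"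
  shows "c k = (0::real)"
proof -
  have "0 = representation (set bs) (\<Sum>i<length bs. c i *\<^sub>R bs ! i) (bs ! k)"
    by (simp add: assms(3) representation_zero)
  also have "\<dots> = (\<Sum>i<length bs. c i * (if bs ! k = bs ! i then 1 else 0))"
    by (subst representation_sum[OF assms(2)])
      (auto intro!: sum.cong simp: representation_scale[OF assms(2)] span_base span_scale
        representation_basis[OF assms(2)])
  also have "\<dots> = (\<Sum>i<length bs. if k = i then c i else 0)"
    using assms(1) k by (intro sum.cong) (auto simp: nth_eq_iff_index_eq)
  also have "\<dots> = c k" using k by simp
  finally show ?thesis by simp
qed

text \<open>A complex polynomial has as many roots as its degree, which for the characteristic
  polynomial is the length of the basis.\<close>

lemma size_restriction_eigenvalues:
  assumes "basis_list_of V bs"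
  shows "size (restriction_eigenvalues f bs) = dim V"
proof -
  have "map_mat complex_of_real (restriction_matrix f bs) \<in> carrier_mat (length bs) (length bs)"
    by (simp add: restriction_matrix_def)
  then have "size (restriction_eigenvalues f bs) = length bs"
    by (simp add: restriction_eigenvalues_def size_proots_complex degree_monic_char_poly)
  also have "\<dots> = dim V"
    using assms dim_span_eq_card_independent[of "set bs"]
    by (simp add: basis_list_of_def distinct_card)
  finally show ?thesis .
qed

text \<open>The restriction matrix is real, so the real and imaginary parts of the coordinates of a
  complex eigenvector, used as coefficients over \<open>bs\<close>, give \<open>x\<close> and
  \<open>y\<close>.\<close>

lemma restriction_eigenvalue_real_eigenvectors:
  assumes basis: "basis_list_of V bs" and "linear f" and inv: "f ` V \<subseteq> V"
    and z: "z \<in># restriction_eigenvalues f bs"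
  obtains x y where "x \<in> V" "y \<in> V" "x \<noteq> 0 \<or> y \<noteq> 0"
    "f x = Re z *\<^sub>R x - Im z *\<^sub>R y" "f y = Im z *\<^sub>R x + Re z *\<^sub>R y"
proof -
  interpret f: linear f by fact
  have bs: "distinct bs" "independent (set bs)" "span (set bs) = V"
    using basis by (auto simp: basis_list_of_def)
  define n where "n = length bs"
  define M where "M = restriction_matrix f bs"
  define Mc where "Mc = map_mat complex_of_real M"
  have M: "M \<in> carrier_mat n n" and Mc: "Mc \<in> carrier_mat n n"
    by (simp_all add: M_def Mc_def n_def restriction_matrix_def)
  \<comment> \<open>Elements of \<open>proots\<close> are the roots only for a nonzero
    polynomial.\<close>
  have "char_poly Mc \<noteq> 0"
    using degree_monic_char_poly[OF Mc] by auto
  then have "eigenvalue Mc z"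
    using z unfolding eigenvalue_root_char_poly[OF Mc]
    by (simp add: restriction_eigenvalues_def Mc_def M_def)
  then obtain w where w: "w \<in> carrier_vec n" "w \<noteq> 0\<^sub>v n" "Mc *\<^sub>v w = z \<cdot>\<^sub>v w"
    using Mc by (auto simp: eigenvalue_def eigenvector_def)
  define c where "c i = Matrix.vec_index w i" for i
  have eig: "(\<Sum>j<n. of_real (M $$ (i, j)) * c j) = z * c i" if "i < n" for i
  proof -
    have "Matrix.vec_index (Mc *\<^sub>v w) i = z * c i"
      using that w by (simp add: c_def)
    then show ?thesis
      using that w M
      by (simp add: Mc_def c_def scalar_prod_def lessThan_atLeast0)
  qed
  define comb where "comb g = (\<Sum>i<n. g i *\<^sub>R bs ! i)" for g :: "nat \<Rightarrow> real"
  have in_V: "comb g \<in> V" for g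
    unfolding comb_def bs(3)[symmetric]
    by (intro span_sum span_scale span_base) (simp add: n_def)
  have f_comb: "f (comb g) = comb (\<lambda>i. \<Sum>j<n. M $$ (i, j) * g j)" for g
  proof -
    have "f (comb g) = (\<Sum>j<n. g j *\<^sub>R (\<Sum>i<n. M $$ (i, j) *\<^sub>R bs ! i))"
      unfolding comb_def f.sum
      by (intro sum.cong refl)
        (simp add: f.scaleR n_def M_def sum_restriction_matrix_column[OF basis inv])
    also have "\<dots> = (\<Sum>i<n. \<Sum>j<n. (M $$ (i, j) * g j) *\<^sub>R bs ! i)"
      unfolding scaleR_sum_right by (subst sum.swap) (simp add: mult.commute)
    finally show ?thesis by (simp add: comb_def scaleR_sum_left)
  qed
  have "f (comb (\<lambda>i. Re (c i))) = comb (\<lambda>i. Re (z * c i))"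
    unfolding f_comb unfolding comb_def
    by (intro sum.cong refl) (simp add: eig[symmetric])
  also have "\<dots> = Re z *\<^sub>R comb (\<lambda>i. Re (c i)) - Im z *\<^sub>R comb (\<lambda>i. Im (c i))"
    by (simp add: comb_def scaleR_sum_right scaleR_diff_left sum_subtractf)
  finally have re: "f (comb (\<lambda>i. Re (c i))) =
    Re z *\<^sub>R comb (\<lambda>i. Re (c i)) - Im z *\<^sub>R comb (\<lambda>i. Im (c i))" .
  have "f (comb (\<lambda>i. Im (c i))) = comb (\<lambda>i. Im (z * c i))"
    unfolding f_comb unfolding comb_def
    by (intro sum.cong refl) (simp add: eig[symmetric])
  also have "\<dots> = Im z *\<^sub>R comb (\<lambda>i. Re (c i)) + Re z *\<^sub>R comb (\<lambda>i. Im (c i))"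
    by (simp add: comb_def scaleR_sum_right scaleR_add_left sum.distrib)
  finally have im: "f (comb (\<lambda>i. Im (c i))) =
    Im z *\<^sub>R comb (\<lambda>i. Re (c i)) + Re z *\<^sub>R comb (\<lambda>i. Im (c i))" .
  have "comb (\<lambda>i. Re (c i)) \<noteq> 0 \<or> comb (\<lambda>i. Im (c i)) \<noteq> 0"
  proof (rule ccontr)
    assume "\<not> ?thesis"
    then have "Re (c k) = 0" "Im (c k) = 0" if "k < n" for k
      using that sum_scaleR_nth_eq_0[OF bs(1,2)] by (auto simp: comb_def n_def)
    then have "c k = 0" if "k < n" for k
      using that by (simp add: complex_eq_iff)
    then have "w = 0\<^sub>v n"
      using w(1) by (intro eq_vecI) (auto simp: c_def)
    then show False using w(2) by simp
  qed
  with in_V re im show thesis by (intro that) auto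
qed

subsection \<open>Pipe networks\<close>

lemma transpose_mult_stack:
  fixes C :: "real^'m::finite^('f::finite + 'r::finite)"
  shows "transpose C *v stack x y = transpose (upper_block C) *v x + transpose (lower_block C) *v y"
  by (simp add: vec_eq_iff vector_matrix_mult_def stack_def upper_block_def lower_block_def
      UNIV_Plus_UNIV[symmetric] sum.Plus del: UNIV_Plus_UNIV)

lemma transpose_incidence_nth:
  assumes "src m \<noteq> tgt m"
  shows "(transpose (incidence_matrix src tgt) *v x) $ m = x $ src m - x $ tgt m"
proof -
  have "(transpose (incidence_matrix src tgt) *v x) $ m =
    (\<Sum>i\<in>UNIV. (if i = src m then x $ i else 0) - (if i = tgt m then x $ i else 0))"
    using assms
    by (auto simp: vector_matrix_mult_def incidence_matrix_def intro!: sum.cong)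
  then show ?thesis by (simp add: sum_subtractf)
qed

text \<open>The transposed incidence matrix takes differences along pipes. Extended by zero to the
  reservoirs, \<open>x\<close> is therefore constant on the connected graph, with the value
  zero.\<close>

lemma transpose_upper_incidence_inj:
  fixes src tgt :: "'m::finite \<Rightarrow> 'f::finite + 'r::finite"
  assumes loops: "no_self_loops src tgt" and conn: "connected_graph src tgt"
    and "transpose (upper_block (incidence_matrix src tgt)) *v x = 0"
  shows "x = 0"
proof -
  define X where "X = stack x (0 :: real^'r)"
  have "transpose (incidence_matrix src tgt) *v X = 0"
    using assms(3) by (simp add: X_def transpose_mult_stack del: transpose_matrix_vector)
  then have edge: "X $ src m = X $ tgt m" for m
    using loops transpose_incidence_nth[of src m tgt X]
    by (simp add: no_self_loops_def del: transpose_matrix_vector)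
  have "X $ i = X $ j" if "(adjacent src tgt)\<^sup>*\<^sup>* i j" for i j
    using that by induction (auto simp: adjacent_def edge)
  \<comment> \<open>\<open>Inr undefined\<close> is merely some reservoir, and \<open>X\<close> is
    zero at all of them.\<close>
  then have "X $ Inl i = X $ Inr undefined" for i
    using conn by (auto simp: connected_graph_def)
  then show ?thesis
    by (simp add: X_def stack_def vec_eq_iff)
qed

section \<open>Flow dynamics and its Jacobian in terms of residuals\<close>

context weighted_projection
begin

text \<open>The energies computed at the free nodes are minus the coefficients fitted to the vector
  inside \<open>residual\<close>.\<close>

lemma flow_rhs_eq_residual:
  assumes "upper_block C = A"
  shows "flow_rhs C (diag d) h2 q Q =
    diag d *v residual (transpose (lower_block C) *v h2 - (\<chi> m. q m (Q $ m)))"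
  unfolding flow_rhs_def Let_def residual_def assms
  by (simp add: matrix_vector_mul_assoc[symmetric] transpose_mult_stack assms
      matrix_vector_right_distrib matrix_vector_mult_diff_distrib algebra_simps
      del: transpose_matrix_vector)

lemma J_dyn_mult_eq_residual:
  "J_dyn A (diag d) q Q *v v = - (diag d *v residual (diag (\<chi> m. deriv (q m) (Q $ m)) *v v))"
  unfolding J_dyn_def residual_def
  by (simp add: matrix_vector_mul_assoc[symmetric] matrix_vector_mult_diff_distrib
      matrix_vector_mult_diff_rdistrib del: transpose_matrix_vector)

text \<open>The flow is a fixed linear map applied to a constant minus \<open>q\<close>, so the
  chain rule only has to differentiate \<open>q\<close> componentwise.\<close>

lemma flow_rhs_has_derivative:
  assumes "upper_block C = A" and diff: "\<And>m. q m differentiable (at (Q $ m))"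
  shows "(flow_rhs C (diag d) h2 q has_derivative (\<lambda>v. J_dyn A (diag d) q Q *v v)) (at Q)"
proof -
  have "((\<lambda>Q. q m (Q $ m)) has_derivative (\<lambda>v. deriv (q m) (Q $ m) * v $ m)) (at Q)" for m
  proof -
    have "(q m has_derivative (*) (deriv (q m) (Q $ m))) (at (Q $ m))"
      using diff[of m]
      by (simp add: DERIV_deriv_iff_real_differentiable has_field_derivative_def[symmetric])
    then show ?thesis
      by (rule has_derivative_compose[rotated])
        (rule bounded_linear.has_derivative[OF bounded_linear_vec_nth has_derivative_ident])
  qed
  then have q: "((\<lambda>Q. \<chi> m. q m (Q $ m)) has_derivative
      (\<lambda>v. diag (\<chi> m. deriv (q m) (Q $ m)) *v v)) (at Q)"
    by (subst has_derivative_componentwise_within)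
      (auto simp: Basis_vec_def inner_axis)
  have lin: "linear (\<lambda>w. diag d *v residual w)"
    using linear_compose[OF linear_residual matrix_vector_mul_linear] by (simp add: o_def)
  then have "bounded_linear (\<lambda>w. diag d *v residual w)"
    by (simp add: linear_conv_bounded_linear)
  from bounded_linear.has_derivative[OF this has_derivative_diff[OF has_derivative_const q,
        of "transpose (lower_block C) *v h2"]]
  show ?thesis
    unfolding flow_rhs_eq_residual[OF assms(1)] J_dyn_mult_eq_residual
    by (simp add: linear_neg[OF lin] del: transpose_matrix_vector)
qed

text \<open>\<open>A\<close> annihilates the right-hand side, so \<open>A *v Q t\<close> has zero
  derivative on an interval and stays constant.\<close>

lemma solution_confined:
  assumes "upper_block C = A" and sol: "solves_on (flow_rhs C (diag d) h2 q) Q {0..T}"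
    and "Q 0 \<in> flow_space A b" and t: "t \<in> {0..T}"
  shows "Q t \<in> flow_space A b"
proof -
  have "((\<lambda>t. A *v Q t) has_derivative (\<lambda>h. 0)) (at s within {0..T})" if "s \<in> {0..T}" for s
  proof -
    have "(Q has_vector_derivative flow_rhs C (diag d) h2 q (Q s)) (at s within {0..T})"
      using sol that by (simp add: solves_on_def)
    from bounded_linear.has_vector_derivative[OF matrix_vector_mul_bounded_linear this, of A]
    show ?thesis
      by (simp add: flow_rhs_eq_residual[OF assms(1)] has_vector_derivative_def)
  qed
  then obtain c where "\<And>s. s \<in> {0..T} \<Longrightarrow> A *v Q s = c"
    using has_derivative_zero_constant[of "{0..T}" "\<lambda>t. A *v Q t"] by auto
  then show ?thesis
    using assms(3) t by (auto simp: flow_space_def)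
qed

lemma J_dyn_maps_ker: "(\<lambda>v. J_dyn A (diag d) q Q *v v) ` matrix_ker A \<subseteq> matrix_ker A"
  by (auto simp: J_dyn_mult_eq_residual matrix_ker_def linear_neg[OF matrix_vector_mul_linear])

lemma J_dyn_restriction_eigenvalue:
  assumes pos: "\<And>m. deriv (q m) (Q $ m) > 0"
    and basis: "basis_list_of (matrix_ker A) bs"
    and z: "z \<in># restriction_eigenvalues (\<lambda>v. J_dyn A (diag d) q Q *v v) bs"
  shows "z \<in> \<real> \<and> Re z < 0"
proof -
  let ?J = "J_dyn A (diag d) q Q"
  define e where "e = (\<chi> m. deriv (q m) (Q $ m))"
  have e: "e $ m > 0" for m using pos by (simp add: e_def)
  \<comment> \<open>Pairing with the weight \<open>e\<close> puts \<open>diag e\<close> on both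
    sides of the symmetric residual form, which makes the Jacobian self-adjoint.\<close>
  have J: "?J *v v = - (diag d *v residual (diag e *v v))" for v
    by (simp add: J_dyn_mult_eq_residual e_def)
  define B where "B u v = u \<bullet> (diag e *v v)" for u v
  obtain x y where xy: "x \<in> matrix_ker A" "y \<in> matrix_ker A" "x \<noteq> 0 \<or> y \<noteq> 0"
    "?J *v x = Re z *\<^sub>R x - Im z *\<^sub>R y" "?J *v y = Im z *\<^sub>R x + Re z *\<^sub>R y"
    by (rule restriction_eigenvalue_real_eigenvectors[OF basis _ J_dyn_maps_ker z])
      (simp_all add: matrix_vector_mul_linear)
  have pos_def: "B u u > 0" if "u \<noteq> 0" for u
    using that inner_diag_nonneg[of e u] inner_diag_eq_0[of e u] e
    by (fastforce simp: B_def less_le)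
  have BJ: "B u (?J *v v) = - ((diag e *v u) \<bullet> (diag d *v residual (diag e *v v)))" for u v
    by (simp add: B_def inner_diag J)
  have "Im z = 0 \<and> Re z < 0"
  proof (rule self_adjoint_negative_eigenvalue[OF xy, of B])
    show "linear (B u)" for u
      unfolding B_def by (intro linearI)
        (simp_all add: matrix_vector_right_distrib matrix_vector_mult_scaleR inner_add_right)
    show "B u v = B v u" for u v
      unfolding B_def by (metis inner_commute inner_diag)
    show "B u (?J *v v) = B v (?J *v u)" for u v
      by (simp add: BJ inner_weighted_residual_commute)
    \<comment> \<open>The vector \<open>u\<close> is its own witness: it lies in the kernel and its
      product with \<open>diag e *v u\<close> is positive.\<close>
    show "B u (?J *v u) < 0" if "u \<in> matrix_ker A" "u \<noteq> 0" for u
      using inner_weighted_residual_pos[of u "diag e *v u"] pos_def[OF that(2)] that(1)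
      unfolding BJ by (simp add: B_def matrix_ker_def)
  qed (fact pos_def)
  then show ?thesis by (simp add: complex_is_Real_iff)
qed

end

theorem mainTheorem1:
  fixes src tgt :: "'m::finite \<Rightarrow> 'f::finite + 'r::finite"
    and I :: "'m \<Rightarrow> real"
    and R u :: "'m \<Rightarrow> real \<Rightarrow> real"
    and h2 :: "real^'r" and Qext :: "real^'f" and Qstar :: "real^'m"
  defines "C \<equiv> incidence_matrix src tgt"
  defines "C1 \<equiv> upper_block C"
  defines "D \<equiv> inv_inertia I"
  defines "q \<equiv> pipe_q R u"
  defines "F \<equiv> flow_rhs C D h2 q"
  defines "J \<equiv> J_dyn C1 D q Qstar"
  assumes "no_self_loops src tgt" and "connected_graph src tgt"
    and "\<And>m. I m > 0"
    and "\<And>m x. q m differentiable (at x)"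
    and "Qstar \<in> flow_space C1 Qext"
    and "F Qstar = 0"
    and "\<And>m. deriv (q m) (Qstar $ m) > 0"
  shows "invertible (C1 ** D ** transpose C1)
    \<and> (\<forall>Q T. solves_on F Q {0..T} \<and> Q 0 \<in> flow_space C1 Qext
          \<longrightarrow> (\<forall>t\<in>{0..T}. Q t \<in> flow_space C1 Qext))
    \<and> (F has_derivative (\<lambda>v. J *v v)) (at Qstar)
    \<and> (\<lambda>v. J *v v) ` matrix_ker C1 \<subseteq> matrix_ker C1
    \<and> (\<forall>bs. basis_list_of (matrix_ker C1) bs \<longrightarrow>
          int (size (restriction_eigenvalues (\<lambda>v. J *v v) bs))
            = int CARD('m) - int CARD('f + 'r) + int CARD('r)
        \<and> (\<forall>z. z \<in># restriction_eigenvalues (\<lambda>v. J *v v) bs \<longrightarrow> z \<in> \<real> \<and> Re z < 0))"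
proof -
  define d where "d = (\<chi> m. 1 / I m)"
  have D: "D = diag d" by (simp add: D_def d_def inv_inertia_def)
  interpret weighted_projection C1 d
  proof
    show "d $ i > 0" for i using assms(9) by (simp add: d_def)
    show "x = 0" if "transpose C1 *v x = 0" for x
      using transpose_upper_incidence_inj assms(7,8) that unfolding C1_def C_def by blast
  qed
  have up: "upper_block C = C1" by (simp add: C1_def)
  have ker: "dim (matrix_ker C1) + CARD('f) = CARD('m)"
    by (rule dim_matrix_ker[OF inj_transpose])
  show ?thesis
  proof (intro conjI allI impI ballI)
    show "invertible (C1 ** D ** transpose C1)"
      unfolding D by (rule gram_invertible)
    show "Q t \<in> flow_space C1 Qext"
      if "solves_on F Q {0..T} \<and> Q 0 \<in> flow_space C1 Qext" "t \<in> {0..T}" for Q T t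
      using that solution_confined[OF up] unfolding F_def D by blast
    show "(F has_derivative (\<lambda>v. J *v v)) (at Qstar)"
      unfolding F_def J_def D by (rule flow_rhs_has_derivative[OF up assms(10)])
    show "(\<lambda>v. J *v v) ` matrix_ker C1 \<subseteq> matrix_ker C1"
      unfolding J_def D by (rule J_dyn_maps_ker)
    fix bs assume bs: "basis_list_of (matrix_ker C1) bs"
    show "int (size (restriction_eigenvalues (\<lambda>v. J *v v) bs))
        = int CARD('m) - int CARD('f + 'r) + int CARD('r)"
      \<comment> \<open>The node type has \<open>CARD('f) + CARD('r)\<close> elements, so
        subtracting \<open>CARD('f)\<close> is the same as subtracting all nodes and adding back the
        reservoirs.\<close>
      using ker by (simp add: size_restriction_eigenvalues[OF bs])
    fix z assume "z \<in># restriction_eigenvalues (\<lambda>v. J *v v) bs"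
    then have "z \<in> \<real> \<and> Re z < 0"
      unfolding J_def D by (rule J_dyn_restriction_eigenvalue[OF assms(13) bs])
    then show "z \<in> \<real>" "Re z < 0" by auto
  qed
qed

end
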